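(* Let $V$ be a vector space of finite dimension $n$ over a field $\mathbb{F}$, endowed with a symplectic form of maximal rank. Then the geometry $\Gamma=\Gamma(V)$ is simply connected.
   Context: For $U\le V$ let $U^\perp$ be its orthogonal with respect to the form and $\mathrm{Rad}(U)=U\cap U^\perp$. Maximal rank means $\dim\mathrm{Rad}(V)=0$ if $n$ is even and $1$ if $n$ is odd. $\Gamma(V)$ has type set $I=\{1,\dots,n-1\}$. Its objects of type $i$ are the $i$-dimensional subspaces $U\le V$ with $U\cap\mathrm{Rad}(V)=0$ and $\dim\mathrm{Rad}(U)\le 1$. Each object is incident with itself, and objects $X,Y$ with $\dim X<\dim Y$ are incident iff $X\subseteq Y$ and $X\cap\mathrm{Rad}(Y)=0$. Distinct objects of equal dimension are not incident. A path is a sequence of objects $x_0,\dots,x_k$ with consecutive objects distinct and incident; a cycle based at $x$ is a path with $x_0=x=x_k$. Two paths are homotopy equivalent if one is obtained from the other by a finite number of insertions or eliminations of cycles of length $2$ or $3$. $\Gamma$ is simply connected if its incidence graph is connected and every cycle is homotopy equivalent to a cycle of length $0$ (that is, its fundamental group is trivial).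
   Formalization: The formal theorem excludes n = 2, n = 3, and n = 5 over the field with two elements; in exactly these cases the geometry is not simply connected (disconnected for n = 2, nontrivial fundamental group in the other two). *)

theory Defs
  imports Complex_Main
begin

record ('a, 't) geometry =
  type_set :: "'t set"
  objects :: "'a set"
  type_of :: "'a \<Rightarrow> 't"
  incident :: "'a \<Rightarrow> 'a \<Rightarrow> bool"

text \<open>A path \<open>x\<^sub>0, \<dots>, x\<^sub>k\<close> is the nonempty list of its vertices; its length \<open>k\<close> is one less
  than the length of the list.\<close>

definition is_path :: "('a, 't) geometry \<Rightarrow> 'a list \<Rightarrow> bool" where
  "is_path G xs \<longleftrightarrow>
     xs \<noteq> [] \<and> set xs \<subseteq> objects G \<and> successively (\<lambda>x y. x \<noteq> y \<and> incident G x y) xs"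

definition path_length :: "'a list \<Rightarrow> nat" where
  "path_length xs = length xs - 1"

definition is_cycle :: "('a, 't) geometry \<Rightarrow> 'a \<Rightarrow> 'a list \<Rightarrow> bool" where
  "is_cycle G x xs \<longleftrightarrow> is_path G xs \<and> hd xs = x \<and> last xs = x"

text \<open>Inserting a cycle \<open>c\<close> based at \<open>x\<close> replaces one occurrence of the vertex \<open>x\<close> on a path
  by \<open>c\<close>, which starts and ends with \<open>x\<close>.\<close>

inductive inserts_cycle :: "('a, 't) geometry \<Rightarrow> 'a list \<Rightarrow> 'a list \<Rightarrow> bool" for G where
  "\<lbrakk>is_path G (p @ [x] @ q); is_cycle G x c; path_length c \<in> {2, 3}\<rbrakk>
     \<Longrightarrow> inserts_cycle G (p @ [x] @ q) (p @ c @ q)"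

definition homotopic_in :: "('a, 't) geometry \<Rightarrow> 'a list \<Rightarrow> 'a list \<Rightarrow> bool" where
  "homotopic_in G = (\<lambda>xs ys. inserts_cycle G xs ys \<or> inserts_cycle G ys xs)\<^sup>*\<^sup>*"

definition connected_geometry :: "('a, 't) geometry \<Rightarrow> bool" where
  "connected_geometry G \<longleftrightarrow>
     (\<forall>x \<in> objects G. \<forall>y \<in> objects G. \<exists>xs. is_path G xs \<and> hd xs = x \<and> last xs = y)"

definition simply_connected_geometry :: "('a, 't) geometry \<Rightarrow> bool" where
  "simply_connected_geometry G \<longleftrightarrow>
     connected_geometry G \<and>
     (\<forall>x xs. is_cycle G x xs \<longrightarrow>
        (\<exists>y c. is_cycle G y c \<and> path_length c = 0 \<and> homotopic_in G xs c))"

definition perp :: "('v \<Rightarrow> 'v \<Rightarrow> 'f::zero) \<Rightarrow> 'v set \<Rightarrow> 'v set" where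
  "perp B U = {v. \<forall>u \<in> U. B u v = 0}"

definition radical :: "('v \<Rightarrow> 'v \<Rightarrow> 'f::zero) \<Rightarrow> 'v set \<Rightarrow> 'v set" where
  "radical B U = U \<inter> perp B U"

context vector_space
begin

text \<open>Symplectic means alternating bilinear, so that characteristic 2 is covered; the form may
  be degenerate.\<close>

definition symplectic_form :: "('b \<Rightarrow> 'b \<Rightarrow> 'a) \<Rightarrow> bool" where
  "symplectic_form B \<longleftrightarrow>
     (\<forall>x. Vector_Spaces.linear scale (*) (B x)) \<and>
     (\<forall>y. Vector_Spaces.linear scale (*) (\<lambda>x. B x y)) \<and>
     (\<forall>x. B x x = 0)"

definition maximal_rank :: "('b \<Rightarrow> 'b \<Rightarrow> 'a) \<Rightarrow> bool" where
  "maximal_rank B \<longleftrightarrow> dim (radical B UNIV) = (if even (dim UNIV) then 0 else 1)"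

text \<open>The whole type \<open>'b\<close> is the space \<open>V\<close>.\<close>

definition symplectic_geometry :: "('b \<Rightarrow> 'b \<Rightarrow> 'a) \<Rightarrow> ('b set, nat) geometry" where
  "symplectic_geometry B =
     \<lparr> type_set = {1..<dim UNIV},
       objects = {U. subspace U \<and> dim U \<in> {1..<dim UNIV} \<and>
                     U \<inter> radical B UNIV = {0} \<and> dim (radical B U) \<le> 1},
       type_of = dim,
       incident = (\<lambda>X Y. X = Y \<or>
         (dim X < dim Y \<and> X \<subseteq> Y \<and> X \<inter> radical B Y = {0}) \<or>
         (dim Y < dim X \<and> Y \<subseteq> X \<and> Y \<inter> radical B X = {0})) \<rparr>"

end

end

theory Submission
  imports Defs
begin

text \<open>
  The objects incident with a fixed one form a cone, in which any two walks with the same ends are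
  homotopic (\<open>walks_in_cone_equiv\<close>). This reduces everything to points and lines:
  once a point is chosen in each object, every incidence \<open>X\<close>, \<open>Y\<close> can
  be replaced, inside the cone of the larger object, by two edges of the collinearity graph
  (\<open>incidence_lifts_to_edges\<close>). The vertices of this graph are the points off the
  radical \<open>R\<close> of \<open>V\<close>, and two of them are joined when they are not
  orthogonal, that is, when they span a hyperbolic line. Two points of an object off its radical
  have a common neighbour in it because a vector space is not the union of two proper subspaces.

  It remains to contract the closed paths of the collinearity graph. This graph has diameter at
  most two, and quadrangles and pentagons break up into triangles by means of explicit sums of
  adjacent vertices; in the form used here, every path of three edges can be replaced by one of
  two edges (\<open>three_path_shortens\<close>), and two paths of two edges with the same ends
  are homotopic (\<open>two_paths_equiv\<close>).

  The heart of the matter is therefore that triangles are null-homotopic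
  (\<open>collinearity_triangle\<close>). A triangle spans a hyperbolic line or a plane of rank
  two, and lies in the cone of this span unless the span meets \<open>R\<close> nontrivially.
  That can happen only in odd dimension. Such a triangle is cut into triangles whose spans avoid
  \<open>R\<close>, either by a common neighbour of its vertices, which exists over every field
  but the one with two elements, or by a comparison with a degenerate triangle on a line, which
  works from dimension 7 on.

  Homotopies are computed on words in which letters may be repeated. There concatenation of paths
  is concatenation of words, and homotopy becomes the congruence generated by stutters and
  possibly degenerate triangles.
\<close>

section \<open>Homotopy of words with repetitions\<close>

locale incidence_graph =
  fixes G :: "('a, 't) geometry"
  assumes incident_refl: "x \<in> objects G \<Longrightarrow> incident G x x"
    and incident_sym: "incident G x y \<Longrightarrow> incident G y x"
begin

definition walk :: "'a list \<Rightarrow> bool" where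
  "walk xs \<longleftrightarrow> xs \<noteq> [] \<and> set xs \<subseteq> objects G \<and> successively (incident G) xs"

text \<open>Triangles may be degenerate: \<open>x = z\<close> turns the second rule, followed by the
  first, into the elimination of a backtrack, so cycles of length 2 need no rule of their own.\<close>
inductive contracts :: "'a list \<Rightarrow> 'a list \<Rightarrow> bool" where
  stutter: "x \<in> objects G \<Longrightarrow> contracts (u @ [x, x] @ v) (u @ [x] @ v)"
| triangle: "\<lbrakk>x \<in> objects G; y \<in> objects G; z \<in> objects G;
     incident G x y; incident G y z; incident G x z\<rbrakk>
     \<Longrightarrow> contracts (u @ [x, y, z] @ v) (u @ [x, z] @ v)"

text \<open>The relation is defined on all words, walks or not, so that it is a congruence for
  concatenation without side conditions. Contractions preserve walks in both directions, which
  is all that the passage to paths in \<open>homotopic_if_equiv_words\<close> requires.\<close>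
definition equiv_words :: "'a list \<Rightarrow> 'a list \<Rightarrow> bool"  (infix "\<approx>" 50) where
  "xs \<approx> ys \<longleftrightarrow> equivclp contracts xs ys"

lemma equiv_words_refl [simp]: "xs \<approx> xs"
  by (simp add: equiv_words_def)

lemma equiv_words_sym: "xs \<approx> ys \<Longrightarrow> ys \<approx> xs"
  unfolding equiv_words_def by (rule equivclp_sym)

lemma equiv_words_trans [trans]: "xs \<approx> ys \<Longrightarrow> ys \<approx> zs \<Longrightarrow> xs \<approx> zs"
  unfolding equiv_words_def by (rule equivclp_trans)

lemma contracts_context: "contracts xs ys \<Longrightarrow> contracts (p @ xs @ q) (p @ ys @ q)"
proof (induction rule: contracts.induct)
  case (stutter x u v)
  then show ?case using contracts.stutter[of x "p @ u" "v @ q"] by simp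
next
  case (triangle x y z u v)
  then show ?case using contracts.triangle[of x y z "p @ u" "v @ q"] by simp
qed

lemma equiv_words_context:
  assumes "xs \<approx> ys"
  shows "p @ xs @ q \<approx> p @ ys @ q"
  using assms unfolding equiv_words_def
proof (induction rule: equivclp_induct)
  case base
  show ?case by simp
next
  case (step y z)
  then show ?case by (meson contracts_context equivclp_into_equivclp)
qed

lemma equiv_words_append:
  assumes "xs \<approx> xs'" "ys \<approx> ys'"
  shows "xs @ ys \<approx> xs' @ ys'"
  using equiv_words_context[OF assms(1), of "[]" ys] equiv_words_context[OF assms(2), of xs' "[]"]
  by (auto intro: equiv_words_trans)

lemma equiv_stutter: "x \<in> objects G \<Longrightarrow> [x, x] \<approx> [x]"
  using contracts.stutter[of x "[]" "[]"] by (auto simp: equiv_words_def)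

lemma equiv_triangle:
  "\<lbrakk>x \<in> objects G; y \<in> objects G; z \<in> objects G;
    incident G x y; incident G y z; incident G x z\<rbrakk> \<Longrightarrow> [x, y, z] \<approx> [x, z]"
  using contracts.triangle[of x y z "[]" "[]"] by (auto simp: equiv_words_def)

lemma equiv_backtrack:
  assumes "x \<in> objects G" "y \<in> objects G" "incident G x y"
  shows "[x, y, x] \<approx> [x]"
  using equiv_triangle[of x y x] equiv_stutter[of x] assms incident_refl incident_sym
  by (meson equiv_words_trans)

lemma walk_append:
  "walk xs \<Longrightarrow> walk ys \<Longrightarrow> incident G (last xs) (hd ys) \<Longrightarrow> walk (xs @ ys)"
  by (auto simp: walk_def successively_append_iff)

text \<open>Sliding the walk one vertex at a time along the triangles with apex \<open>Z\<close>.\<close>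
lemma walk_cone:
  assumes "walk xs" and "\<And>x. x \<in> set xs \<Longrightarrow> incident G x Z" and "Z \<in> objects G"
  shows "xs \<approx> [hd xs, Z, last xs]"
  using assms(1,2)
proof (induction xs)
  case Nil
  then show ?case by (simp add: walk_def)
next
  case (Cons x xs)
  have x: "x \<in> objects G" "incident G x Z" using Cons.prems by (auto simp: walk_def)
  show ?case
  proof (cases "xs = []")
    case True
    then show ?thesis using equiv_backtrack[OF x(1) assms(3) x(2)] by (simp add: equiv_words_sym)
  next
    case False
    have w: "walk xs" and i: "incident G x (hd xs)" and h: "hd xs \<in> objects G"
      using Cons.prems False by (auto simp: walk_def successively_Cons)
    have "x # xs \<approx> [x] @ [hd xs, Z, last xs]"
      using equiv_words_append[OF equiv_words_refl[of "[x]"] Cons.IH[OF w]] Cons.prems(2) by simp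
    also have "\<dots> = [x, hd xs, Z] @ [last xs]" by simp
    also have "\<dots> \<approx> [x, Z] @ [last xs]"
      by (intro equiv_words_append equiv_triangle equiv_words_refl)
         (use x h i assms(3) Cons.prems(2) False in auto)
    finally show ?thesis using False by simp
  qed
qed

text \<open>Apart from stutters and backtracks, every homotopy of the geometry comes from such a
  cone, with the span of the points involved or the larger of two incident objects as apex.\<close>
lemma walks_in_cone_equiv:
  assumes "walk xs" "walk ys" "hd xs = hd ys" "last xs = last ys" "Z \<in> objects G"
    and "\<And>x. x \<in> set xs \<union> set ys \<Longrightarrow> incident G x Z"
  shows "xs \<approx> ys"
proof -
  have "xs \<approx> [hd xs, Z, last xs]" by (rule walk_cone) (use assms in auto)
  also have "\<dots> \<approx> ys"
    unfolding assms(3,4) by (rule equiv_words_sym, rule walk_cone) (use assms in auto)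
  finally show ?thesis .
qed

lemma is_path_iff_walk: "is_path G xs \<longleftrightarrow> walk xs \<and> distinct_adj xs"
  by (auto simp: is_path_def walk_def distinct_adj_def successively_altdef)
     (induction xs rule: induct_list012; auto)+

lemma is_path_remdups_adj: "walk xs \<Longrightarrow> is_path G (remdups_adj xs)"
  unfolding is_path_iff_walk by (auto simp: walk_def intro: successively_remdups_adjI)

lemma homotopic_refl [simp]: "homotopic_in G xs xs"
  by (simp add: homotopic_in_def)

lemma homotopic_sym: "homotopic_in G xs ys \<Longrightarrow> homotopic_in G ys xs"
  unfolding homotopic_in_def
  by (rule sympD[OF symp_rtranclp]) (auto simp: symp_def)

lemma homotopic_trans [trans]:
  "homotopic_in G xs ys \<Longrightarrow> homotopic_in G ys zs \<Longrightarrow> homotopic_in G xs zs"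
  unfolding homotopic_in_def by (rule rtranclp_trans)

lemma homotopic_insert_cycle:
  assumes "is_path G (p @ [x] @ q)" "is_cycle G x c" "path_length c \<in> {2, 3}"
  shows "homotopic_in G (p @ [x] @ q) (p @ c @ q)"
  unfolding homotopic_in_def using inserts_cycle.intros[OF assms] by blast

lemma path_backtrack_homotopic:
  assumes "is_path G (p @ [x, y, x] @ q)"
  shows "homotopic_in G (p @ [x, y, x] @ q) (p @ [x] @ q)"
proof (rule homotopic_sym, rule homotopic_insert_cycle)
  show "is_path G (p @ [x] @ q)"
    using assms by (auto simp: is_path_def successively_append_iff successively_Cons split: if_splits)
  show "is_cycle G x [x, y, x]"
    using assms by (auto simp: is_cycle_def is_path_def successively_append_iff)
qed (simp add: path_length_def)

text \<open>Both paths expand to the same path: the short one by inserting the 3-cycle \<open>x, y,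
  z, x\<close> at \<open>x\<close>, the long one by inserting the 2-cycle \<open>z, x, z\<close>
  at \<open>z\<close>.\<close>
lemma path_triangle_homotopic:
  assumes path: "is_path G (p @ [x, y, z] @ q)" and xz: "x \<noteq> z" "incident G x z"
  shows "homotopic_in G (p @ [x, y, z] @ q) (p @ [x, z] @ q)"
proof -
  have x: "incident G z x" and "is_path G [x, y, z]"
    using path xz incident_sym by (auto simp: is_path_def successively_append_iff)
  have short: "is_path G (p @ [x] @ z # q)"
    using path xz by (auto simp: is_path_def successively_append_iff successively_Cons)
  have "is_cycle G x [x, y, z, x]"
    using \<open>is_path G [x, y, z]\<close> x xz by (auto simp: is_cycle_def is_path_def)
  from homotopic_insert_cycle[OF short this]
  have 1: "homotopic_in G (p @ [x, z] @ q) (p @ [x, y, z, x, z] @ q)"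
    by (simp add: path_length_def)
  have long: "is_path G ((p @ [x, y]) @ [z] @ q)" using path by simp
  have "is_cycle G z [z, x, z]"
    using \<open>is_path G [x, y, z]\<close> x xz by (auto simp: is_cycle_def is_path_def)
  from homotopic_insert_cycle[OF long this]
  have 2: "homotopic_in G (p @ [x, y, z] @ q) (p @ [x, y, z, x, z] @ q)"
    by (simp add: path_length_def)
  show ?thesis using 1 2 homotopic_sym homotopic_trans by blast
qed

lemma walk_contracts_iff: "contracts xs ys \<Longrightarrow> walk xs \<longleftrightarrow> walk ys"
  by (induction rule: contracts.induct)
     (auto simp: walk_def successively_append_iff successively_Cons incident_refl)

text \<open>Removing adjacent repetitions turns a stutter into the identity, and a triangle into the
  identity, a 2-cycle or a genuine triangle according to which of its vertices coincide.\<close>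
lemma homotopic_if_contracts:
  assumes "contracts xs ys" "walk xs"
  shows "homotopic_in G (remdups_adj xs) (remdups_adj ys)"
  using assms
proof (induction rule: contracts.induct)
  case (stutter x u v)
  have "remdups_adj (u @ [x, x] @ v) = remdups_adj (u @ [x] @ v)"
    using remdups_adj_append[of u x "x # v"] remdups_adj_append[of u x v] by simp
  then show ?case by simp
next
  case (triangle x y z u v)
  obtain U where U: "remdups_adj (u @ [x]) = U @ [x]"
    by (metis append_butlast_last_id last_remdups_adj last_snoc remdups_adj_Nil_iff snoc_eq_iff_butlast)
  obtain V where V: "remdups_adj (z # v) = z # V"
    by (metis remdups_adj_Cons_alt)
  have split: "remdups_adj (u @ x # w) = U @ remdups_adj (x # w)" for w
    using remdups_adj_append[of u x w] U by simp
  have path: "is_path G (remdups_adj (u @ [x, y, z] @ v))"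
    using triangle.prems by (rule is_path_remdups_adj)
  consider "x = y \<or> y = z" | "x \<noteq> y" "y \<noteq> z" "x = z" | "x \<noteq> y" "y \<noteq> z" "x \<noteq> z" by blast
  then show ?case
  proof cases
    case 1
    then have "remdups_adj (u @ [x, y, z] @ v) = remdups_adj (u @ [x, z] @ v)"
      by (auto simp: split)
    then show ?thesis by simp
  next
    case 2
    then have "remdups_adj (u @ [x, y, z] @ v) = U @ [x, y, x] @ V"
      and "remdups_adj (u @ [x, z] @ v) = U @ [x] @ V"
      using V split[of "y # z # v"] split[of "z # v"] by simp_all
    then show ?thesis using path path_backtrack_homotopic by metis
  next
    case 3
    then have "remdups_adj (u @ [x, y, z] @ v) = U @ [x, y, z] @ V"
      and "remdups_adj (u @ [x, z] @ v) = U @ [x, z] @ V"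
      using V split[of "y # z # v"] split[of "z # v"] by simp_all
    then show ?thesis using path path_triangle_homotopic 3 triangle.hyps by metis
  qed
qed

lemma homotopic_if_equiv_words:
  assumes "xs \<approx> ys" "walk xs"
  shows "homotopic_in G (remdups_adj xs) (remdups_adj ys)"
proof -
  have "walk ys \<and> homotopic_in G (remdups_adj xs) (remdups_adj ys)"
    using assms unfolding equiv_words_def
  proof (induction rule: equivclp_induct)
    case (step y z)
    then show ?case
      by (metis homotopic_if_contracts homotopic_sym homotopic_trans walk_contracts_iff)
  qed simp
  then show ?thesis ..
qed

lemma simply_connected_if_walks:
  assumes conn: "\<And>x y. x \<in> objects G \<Longrightarrow> y \<in> objects G \<Longrightarrow> \<exists>xs. walk xs \<and> hd xs = x \<and> last xs = y"
    and null: "\<And>xs. walk xs \<Longrightarrow> hd xs = last xs \<Longrightarrow> xs \<approx> [hd xs]"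
  shows "simply_connected_geometry G"
  unfolding simply_connected_geometry_def connected_geometry_def
proof (intro conjI ballI allI impI)
  fix x y assume "x \<in> objects G" "y \<in> objects G"
  with conn obtain xs where "walk xs" "hd xs = x" "last xs = y" by blast
  then show "\<exists>xs. is_path G xs \<and> hd xs = x \<and> last xs = y"
    using is_path_remdups_adj by (intro exI[of _ "remdups_adj xs"]) auto
next
  fix x xs assume c: "is_cycle G x xs"
  then have xs: "walk xs" "remdups_adj xs = xs" "hd xs = x" "last xs = x"
    by (auto simp: is_cycle_def is_path_iff_walk distinct_adj_altdef)
  have "homotopic_in G xs [x]"
    using homotopic_if_equiv_words[OF null xs(1)] xs by simp
  moreover have "is_cycle G x [x]"
    using xs by (auto simp: is_cycle_def is_path_def walk_def)
  ultimately show "\<exists>y c. is_cycle G y c \<and> path_length c = 0 \<and> homotopic_in G xs c"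
    by (intro exI[of _ x] exI[of _ "[x]"]) (simp add: path_length_def)
qed

end

section \<open>Alternating forms, hyperbolic pairs and incidence\<close>

locale symplectic_space = finite_dimensional_vector_space scale Basis
  for scale :: "'f::field \<Rightarrow> 'v::ab_group_add \<Rightarrow> 'v" (infixr "*s" 75)
    and Basis :: "'v set" +
  fixes B :: "'v \<Rightarrow> 'v \<Rightarrow> 'f"
  assumes form: "symplectic_form B"
begin

abbreviation "R \<equiv> radical B UNIV"

lemma B_add_right: "B x (y + z) = B x y + B x z"
  and B_scale_right: "B x (k *s y) = k * B x y"
  and B_add_left: "B (x + y) z = B x z + B y z"
  and B_scale_left: "B (k *s x) z = k * B x z"
  and B_self [simp]: "B x x = 0"
proof -
  have r: "Vector_Spaces.linear scale (*) (B x)" and l: "Vector_Spaces.linear scale (*) (\<lambda>x. B x z)"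
    and s: "B x x = 0"
    using form by (auto simp: symplectic_form_def)
  show "B x (y + z) = B x y + B x z" "B x (k *s y) = k * B x y"
    using r by (simp_all add: Vector_Spaces.linear_iff)
  show "B (x + y) z = B x z + B y z" "B (k *s x) z = k * B x z"
    using l by (simp_all add: Vector_Spaces.linear_iff)
  show "B x x = 0" by (fact s)
qed

lemma B_skew: "B y x = - B x y"
proof -
  have "0 = B (x + y) (x + y)" by simp
  also have "\<dots> = B x y + B y x" unfolding B_add_left B_add_right by simp
  finally show ?thesis by (metis add.commute eq_neg_iff_add_eq_0)
qed

lemma B_eq_0_commute: "B y x = 0 \<longleftrightarrow> B x y = 0"
  by (subst B_skew) simp

lemma B_zero_right [simp]: "B x 0 = 0"
  using B_scale_right[of x 0 0] by simp

lemma B_zero_left [simp]: "B 0 x = 0"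
  using B_scale_left[of 0 0 x] by simp

lemma B_diff_right: "B x (y - z) = B x y - B x z"
  using B_add_right[of x "y - z" z] by simp

lemma B_diff_left: "B (x - y) z = B x z - B y z"
  using B_add_left[of "x - y" y z] by simp

lemmas B_bilinear = B_add_right B_scale_right B_add_left B_scale_left B_diff_right B_diff_left

lemma mem_radical_iff: "v \<in> radical B U \<longleftrightarrow> v \<in> U \<and> (\<forall>u\<in>U. B v u = 0)"
  by (auto simp: radical_def perp_def B_eq_0_commute)

lemma subspace_radical: "subspace U \<Longrightarrow> subspace (radical B U)"
  unfolding subspace_def by (auto simp: mem_radical_iff B_bilinear)

lemma mem_span_pair_iff: "x \<in> span {a, b} \<longleftrightarrow> (\<exists>i j. x = i *s a + j *s b)"
  by (simp add: span_breakdown_eq[of x a] span_singleton image_iff diff_eq_eq add.commute)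

lemma mem_span_triple_iff: "x \<in> span {a, b, c} \<longleftrightarrow> (\<exists>i j k. x = i *s a + j *s b + k *s c)"
  by (simp add: span_breakdown_eq[of x a] mem_span_pair_iff diff_eq_eq add.commute add.left_commute)

text \<open>The component of \<open>c\<close> orthogonal to the hyperbolic plane spanned by
  \<open>a\<close> and \<open>b\<close>, for \<open>B a b \<noteq> 0\<close>.\<close>
definition proj :: "'v \<Rightarrow> 'v \<Rightarrow> 'v \<Rightarrow> 'v" where
  "proj a b c = c - (B a c / B a b) *s b - (B c b / B a b) *s a"

lemma proj_perp:
  assumes "B a b \<noteq> 0"
  shows "B a (proj a b c) = 0" "B b (proj a b c) = 0"
  using assms B_skew[of a b] B_skew[of c b] by (simp_all add: proj_def B_bilinear)

lemma B_proj:
  assumes "B w a = 0" "B w b = 0"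
  shows "B w (proj a b c) = B w c"
  using assms by (simp add: proj_def B_bilinear)

lemma proj_decomp: "c = (B c b / B a b) *s a + (B a c / B a b) *s b + proj a b c"
  by (simp add: proj_def)

lemma span_triple_proj: "span {a, b, c} = span {a, b, proj a b c}"
proof -
  have "c = (B c b / B a b) *s a + (B a c / B a b) *s b + 1 *s proj a b c"
    using proj_decomp[of c b a] by simp
  then have "c \<in> span {a, b, proj a b c}" unfolding mem_span_triple_iff by blast
  moreover have "proj a b c = (- (B c b / B a b)) *s a + (- (B a c / B a b)) *s b + 1 *s c"
    by (simp add: proj_def)
  then have "proj a b c \<in> span {a, b, c}" unfolding mem_span_triple_iff by blast
  ultimately show ?thesis unfolding span_eq by (simp add: span_base)
qed

text \<open>The span is the hyperbolic plane \<open>span {a, b}\<close> plus an orthogonal complement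
  of dimension at most one, and a hyperbolic plane has zero radical.\<close>
lemma radical_triple_subset:
  assumes "B a b \<noteq> 0"
  shows "radical B (span {a, b, c}) \<subseteq> span {proj a b c}"
proof
  fix x assume x: "x \<in> radical B (span {a, b, c})"
  then obtain i j k where eq: "x = i *s a + j *s b + k *s proj a b c"
    unfolding mem_radical_iff span_triple_proj[of a b c] mem_span_triple_iff by blast
  have "B x a = 0" "B x b = 0"
    using x by (auto simp: mem_radical_iff span_base)
  then have "B a x = 0" "B b x = 0" using B_eq_0_commute by blast+
  with eq proj_perp[OF assms, of c] have "j = 0" "i = 0"
    using assms B_eq_0_commute[of a b] by (auto simp: B_bilinear)
  with eq show "x \<in> span {proj a b c}" by (simp add: span_base span_scale)
qed

lemma hyperbolic_pair_independent_mod_radical: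
  assumes "B a b \<noteq> 0" "B a (i *s a + j *s b) = 0" "B b (i *s a + j *s b) = 0"
  shows "i = 0 \<and> j = 0"
  using assms B_eq_0_commute[of a b] by (auto simp: B_bilinear)

text \<open>A functional \<open>B _ w\<close> that vanishes on \<open>a\<close> and \<open>b\<close>
  but not on \<open>c\<close> kills the \<open>c\<close>-coefficient of a vector of the radical;
  the rest lies in a hyperbolic plane. One \<open>w\<close> can thus serve several spans at
  once.\<close>
lemma span_triple_radical_witness:
  assumes ab: "B a b \<noteq> 0" and w: "B a w = 0" "B b w = 0" "B c w \<noteq> 0"
  shows "span {a, b, c} \<inter> R = {0}"
proof -
  have "x = 0" if x: "x \<in> span {a, b, c}" "x \<in> R" for x
  proof -
    obtain i j k where eq: "x = i *s a + j *s b + k *s c"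
      using x(1) unfolding mem_span_triple_iff by blast
    have 0: "B x z = 0" for z using x(2) by (simp add: mem_radical_iff)
    have "k = 0" using 0[of w] w by (simp add: eq B_bilinear)
    moreover have "i = 0 \<and> j = 0"
      using 0[of a] 0[of b] eq calculation
      by (intro hyperbolic_pair_independent_mod_radical[OF ab]) (auto simp: B_eq_0_commute)
    ultimately show ?thesis using eq by simp
  qed
  then show ?thesis by (auto simp: span_zero mem_radical_iff)
qed

lemma radical_hyperbolic_line:
  assumes "B a b \<noteq> 0"
  shows "radical B (span {a, b}) = {0}"
proof -
  have "x = 0" if x: "x \<in> radical B (span {a, b})" for x
  proof -
    obtain i j where eq: "x = i *s a + j *s b"
      using x unfolding mem_radical_iff mem_span_pair_iff by blast
    have "B x a = 0" "B x b = 0"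
      using x by (auto simp: mem_radical_iff span_base)
    then show ?thesis using hyperbolic_pair_independent_mod_radical[OF assms, of i j] eq
      by (auto simp: B_eq_0_commute)
  qed
  then show ?thesis by (auto simp: span_zero mem_radical_iff)
qed

text \<open>A vector space is not the union of two proper subspaces.\<close>
lemma exists_common_nonperp:
  assumes "subspace Y" "\<exists>y\<in>Y. B a y \<noteq> 0" "\<exists>y\<in>Y. B b y \<noteq> 0"
  shows "\<exists>y\<in>Y. B a y \<noteq> 0 \<and> B b y \<noteq> 0"
proof -
  obtain y z where yz: "y \<in> Y" "z \<in> Y" "B a y \<noteq> 0" "B b z \<noteq> 0" using assms by blast
  consider "B b y \<noteq> 0" | "B a z \<noteq> 0" | "B b y = 0" "B a z = 0" by blast
  then show ?thesis
  proof cases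
    case 3
    then show ?thesis using yz subspace_add[OF assms(1)] by (intro bexI[of _ "y + z"]) (auto simp: B_bilinear)
  qed (use yz in auto)
qed

lemma exists_not_in_span:
  assumes "finite S" "card S < dim UNIV"
  shows "\<exists>v. v \<notin> span S"
  using dim_le_card[of UNIV S] assms by (metis UNIV_I leD subsetI)

abbreviation "\<Gamma> \<equiv> symplectic_geometry B"

lemma objects_iff:
  "X \<in> objects \<Gamma> \<longleftrightarrow> subspace X \<and> 1 \<le> dim X \<and> dim X < dim UNIV \<and> X \<inter> R = {0} \<and> dim (radical B X) \<le> 1"
  unfolding symplectic_geometry_def by auto

lemma incident_iff: "incident \<Gamma> X Y \<longleftrightarrow> X = Y \<or>
         (dim X < dim Y \<and> X \<subseteq> Y \<and> X \<inter> radical B Y = {0}) \<or>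
         (dim Y < dim X \<and> Y \<subseteq> X \<and> Y \<inter> radical B X = {0})"
  unfolding symplectic_geometry_def by simp

sublocale incidence_graph \<Gamma>
  by unfold_locales (auto simp: incident_iff)

abbreviation homotopic_words (infix "\<approx>" 50) where
  "xs \<approx> ys \<equiv> equiv_words xs ys"

lemma incident_if_subset:
  assumes "subspace X" "subspace Y" "X \<subseteq> Y" "X \<inter> radical B Y = {0}"
  shows "incident \<Gamma> X Y"
proof (cases "dim X = dim Y")
  case True
  then have "X = Y" using assms by (intro subspace_dim_equal) auto
  then show ?thesis by (simp add: incident_iff)
next
  case False
  then have "dim X < dim Y" using dim_subset[OF assms(3)] by simp
  then show ?thesis using assms by (simp add: incident_iff)
qed

lemma incident_point:
  assumes "subspace Y" "a \<in> Y" "y \<in> Y" "B a y \<noteq> 0"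
  shows "incident \<Gamma> (span {a}) Y"
proof (rule incident_if_subset)
  show "span {a} \<subseteq> Y" using assms by (simp add: span_minimal)
  show "span {a} \<inter> radical B Y = {0}"
    using assms subspace_0[OF assms(1)] by (auto simp: span_singleton mem_radical_iff B_bilinear)
qed (use assms in auto)

text \<open>The radical of \<open>Y\<close> meets a hyperbolic line in the radical of that line,
  which is zero.\<close>
lemma incident_line:
  assumes "subspace Y" "a \<in> Y" "b \<in> Y" "B a b \<noteq> 0"
  shows "incident \<Gamma> (span {a, b}) Y"
proof (rule incident_if_subset)
  show sub: "span {a, b} \<subseteq> Y" using assms by (simp add: span_minimal)
  have "span {a, b} \<inter> radical B Y \<subseteq> radical B (span {a, b})"
    using sub unfolding mem_radical_iff subset_iff Int_iff by blast
  then show "span {a, b} \<inter> radical B Y = {0}"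
    using radical_hyperbolic_line[OF assms(4)] subspace_0[OF assms(1)]
    by (auto simp: span_zero mem_radical_iff)
qed (use assms in auto)

end

section \<open>Objects spanned by few points and the word of an edge\<close>

locale large_symplectic_space = symplectic_space scale Basis B
  for scale :: "'f::field \<Rightarrow> 'v::ab_group_add \<Rightarrow> 'v" (infixr "*s" 75)
    and Basis :: "'v set" and B :: "'v \<Rightarrow> 'v \<Rightarrow> 'f" +
  assumes rank: "maximal_rank B"
    and dim_ge_4: "4 \<le> dim UNIV"
    and not_exceptional: "\<not> (dim UNIV = 5 \<and> card (UNIV :: 'f set) = 2)"
begin

lemma dim_radical_le_1: "dim R \<le> 1"
  using rank by (simp add: maximal_rank_def split: if_splits)

lemma span_triple_object:
  assumes ab: "B a b \<noteq> 0" and R: "span {a, b, c} \<inter> R = {0}"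
  shows "span {a, b, c} \<in> objects \<Gamma>"
proof -
  have "dim (span {a, b, c}) \<le> card {a, b, c}"
    by (rule dim_le_card) auto
  also have "\<dots> \<le> 3" by (simp add: card_insert_if)
  finally have "dim (span {a, b, c}) < dim UNIV" using dim_ge_4 by simp
  moreover have "a \<noteq> 0" using ab by auto
  then have "dim {a} = 1" by simp
  moreover have "dim {a} \<le> dim (span {a, b, c})"
    by (rule dim_subset) (simp add: span_base)
  moreover have "dim (radical B (span {a, b, c})) \<le> card {proj a b c}"
    by (rule dim_le_card[OF radical_triple_subset[OF ab]]) simp
  ultimately show ?thesis using R by (simp add: objects_iff)
qed

lemma line_meets_radical_trivially:
  assumes "B a b \<noteq> 0"
  shows "span {a, b} \<inter> R = {0}"
proof -
  have "span {a, b} \<inter> R \<subseteq> radical B (span {a, b})"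
    by (auto simp: mem_radical_iff)
  then show ?thesis using radical_hyperbolic_line[OF assms]
    by (auto simp: span_zero mem_radical_iff)
qed

lemma line_object: "B a b \<noteq> 0 \<Longrightarrow> span {a, b} \<in> objects \<Gamma>"
  using span_triple_object[of a b a] line_meets_radical_trivially[of a b]
  by (simp add: insert_commute)

lemma point_object:
  assumes "B a b \<noteq> 0"
  shows "span {a} \<in> objects \<Gamma>"
proof -
  have "dim (radical B (span {a})) \<le> dim (span {a})"
    by (intro dim_subset) (auto simp: mem_radical_iff)
  moreover have "dim (span {a}) = 1" using assms by auto
  moreover have "span {a} \<inter> R \<subseteq> {0}"
    using line_meets_radical_trivially[OF assms] span_mono[of "{a}" "{a, b}"] by auto
  then have "span {a} \<inter> R = {0}" by (auto simp: span_zero mem_radical_iff)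
  ultimately show ?thesis using dim_ge_4 by (simp add: objects_iff)
qed

text \<open>Points are represented by spanning vectors. The edge between two non-orthogonal points
  passes through the line they span. Edges are concatenated with \<open>@\<close>, which repeats
  the common end point.\<close>
definition edge :: "'v \<Rightarrow> 'v \<Rightarrow> 'v set list" where
  "edge a b = [span {a}, span {a, b}, span {b}]"

lemma hd_edge [simp]: "hd (edge a b) = span {a}"
  and last_edge [simp]: "last (edge a b) = span {b}"
  and edge_neq_Nil [simp]: "edge a b \<noteq> []"
  by (simp_all add: edge_def)

lemma edge_incident:
  assumes "subspace Y" "a \<in> Y" "b \<in> Y" "B a b \<noteq> 0" "x \<in> set (edge a b)"
  shows "incident \<Gamma> x Y"
  using assms incident_point[of Y a b] incident_point[of Y b a] incident_line[of Y a b]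
  by (auto simp: edge_def B_eq_0_commute)

lemma walk_edge:
  assumes "B a b \<noteq> 0"
  shows "walk (edge a b)"
proof -
  have i: "incident \<Gamma> x (span {a, b})" if "x \<in> set (edge a b)" for x
    using edge_incident[OF _ _ _ assms that] by (simp add: span_base)
  then have "incident \<Gamma> (span {a}) (span {a, b})" "incident \<Gamma> (span {a, b}) (span {b})"
    using incident_sym by (auto simp: edge_def)
  then show ?thesis
    using assms point_object[of a b] point_object[of b a] line_object
    by (auto simp: walk_def edge_def B_eq_0_commute)
qed

lemma walk_edges: "B a b \<noteq> 0 \<Longrightarrow> B b c \<noteq> 0 \<Longrightarrow> walk (edge a b @ edge b c)"
  by (intro walk_append walk_edge) (auto intro: incident_refl point_object)

lemma edge_reverse:
  assumes "B a b \<noteq> 0"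
  shows "edge a b @ edge b a \<approx> [span {a}]"
proof (rule walks_in_cone_equiv[where Z = "span {a, b}"])
  show "walk (edge a b @ edge b a)"
    using walk_edges[of a b a] assms by (simp add: B_eq_0_commute)
  show "walk [span {a}]" using point_object[OF assms] by (simp add: walk_def)
  fix x assume "x \<in> set (edge a b @ edge b a) \<union> set [span {a}]"
  then have "x \<in> set (edge a b)" by (auto simp: edge_def insert_commute)
  then show "incident \<Gamma> x (span {a, b})"
    using assms edge_incident[of "span {a, b}" a b x] by (simp add: span_base)
qed (use assms line_object in auto)

lemma edge_end: "B a b \<noteq> 0 \<Longrightarrow> edge a b @ [span {b}] \<approx> edge a b"
  using equiv_words_append[OF equiv_words_refl[of "butlast (edge a b)"] equiv_stutter[OF point_object], of b a]
  by (simp add: edge_def B_eq_0_commute)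

text \<open>The three points and the three lines are all incident with the span of the triangle,
  which is a hyperbolic line or a plane of rank two.\<close>
lemma triangle_in_object:
  assumes ab: "B a b \<noteq> 0" and bc: "B b c \<noteq> 0" and ac: "B a c \<noteq> 0"
    and R: "span {a, b, c} \<inter> R = {0}"
  shows "edge a b @ edge b c \<approx> edge a c"
proof (rule walks_in_cone_equiv[where Z = "span {a, b, c}"])
  show "walk (edge a b @ edge b c)" using walk_edges[OF ab bc] .
  show "walk (edge a c)" using walk_edge[OF ac] .
  show "span {a, b, c} \<in> objects \<Gamma>" using span_triple_object[OF ab R] .
  fix x assume "x \<in> set (edge a b @ edge b c) \<union> set (edge a c)"
  then show "incident \<Gamma> x (span {a, b, c})"
    using ab bc ac edge_incident[of "span {a, b, c}" a b x]
      edge_incident[of "span {a, b, c}" b c x] edge_incident[of "span {a, b, c}" a c x]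
    by (auto simp: span_base)
qed auto

section \<open>Triangles of the collinearity graph\<close>

lemma radical_eq_span:
  assumes "r \<in> R" "r \<noteq> 0"
  shows "R = span {r}"
proof (rule subspace_dim_equal[symmetric])
  show "span {r} \<subseteq> R" using assms by (simp add: span_minimal subspace_radical)
  show "dim R \<le> dim (span {r})" using assms dim_radical_le_1 by simp
qed (auto simp: subspace_radical)

lemma odd_dim_if_radical: "r \<in> R \<Longrightarrow> r \<noteq> 0 \<Longrightarrow> odd (dim UNIV)"
  using rank radical_eq_span[of r] by (auto simp: maximal_rank_def split: if_splits)

lemma nonperp_in_hyperbolic_perp:
  assumes ab: "B a b \<noteq> 0" and m: "B a m = 0" "B b m = 0" "m \<notin> R"
  obtains w where "B a w = 0" "B b w = 0" "B m w \<noteq> 0"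
proof -
  obtain w0 where "B m w0 \<noteq> 0" using m(3) by (auto simp: mem_radical_iff)
  then show thesis
    using that[of "proj a b w0"] proj_perp[OF ab] B_proj[of m a b w0] m by (simp add: B_eq_0_commute)
qed

text \<open>A point \<open>s\<close> that is not orthogonal to any vertex cuts the triangle into
  three triangles. The functional of \<open>w\<close> shows that none of the three spans meets
  the radical, even if the original span does.\<close>
lemma triangle_via_common_neighbour:
  assumes ab: "B a b \<noteq> 0" and bc: "B b c \<noteq> 0" and ac: "B a c \<noteq> 0"
    and s: "B a s \<noteq> 0" "B b s \<noteq> 0" "B c s \<noteq> 0"
    and w: "B a w = 0" "B b w = 0" "B c w = 0" "B s w \<noteq> 0"
  shows "edge a b @ edge b c \<approx> edge a c"
proof -
  have good: "span {x, s, y} \<inter> R = {0}" if "B x y \<noteq> 0" "B x w = 0" "B y w = 0" for x y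
    using span_triple_radical_witness[OF that w(4)] by (simp add: insert_commute)
  have tri: "edge x s @ edge s y \<approx> edge x y"
    if "B x y \<noteq> 0" "B x w = 0" "B y w = 0" "B x s \<noteq> 0" "B y s \<noteq> 0" for x y
    using that good[of x y] by (intro triangle_in_object) (auto simp: B_eq_0_commute)
  have "edge a b @ edge b c \<approx> edge a s @ edge s b @ edge b c"
    using equiv_words_append[OF tri[of a b] equiv_words_refl] ab s w
    by (auto intro: equiv_words_sym)
  also have "\<dots> \<approx> edge a s @ edge s c"
    using span_triple_radical_witness[OF bc w(2,3,4)] bc s
    by (intro equiv_words_append equiv_words_refl triangle_in_object)
       (auto simp: B_eq_0_commute insert_commute)
  also have "\<dots> \<approx> edge a c" using tri[of a c] ac s w by auto
  finally show ?thesis .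
qed

text \<open>The triangles \<open>a, x, u\<close> and \<open>x, y, u\<close> and \<open>y, c,
  u\<close> push the path through \<open>u\<close> off to the path through \<open>x\<close> and
  \<open>y\<close>. What matters is that \<open>u\<close> enters the hypotheses only through the
  functional \<open>B u _\<close>, up to a nonzero factor, so a point congruent to a multiple of
  \<open>u\<close> modulo the radical can take its place.\<close>
lemma triangle_meeting_radical_via_path:
  assumes au: "B a u \<noteq> 0" and uc: "B u c \<noteq> 0"
    and ax: "B a x \<noteq> 0" and xy: "B x y \<noteq> 0" and yc: "B y c \<noteq> 0"
    and ux: "B u x \<noteq> 0" and uy: "B u y \<noteq> 0"
    and w: "B a w = 0" "B u w = 0" "B y w = 0" "B x w \<noteq> 0"
    and w': "B u w' = 0" "B c w' = 0" "B y w' \<noteq> 0"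
  shows "edge a u @ edge u c \<approx> edge a x @ edge x y @ edge y c"
proof -
  have 1: "edge a x @ edge x u \<approx> edge a u"
    using span_triple_radical_witness[OF au w(1,2,4)] au ax ux
    by (intro triangle_in_object) (auto simp: B_eq_0_commute insert_commute)
  have 2: "edge x y @ edge y u \<approx> edge x u"
    using span_triple_radical_witness[OF uy w(2,3,4)] xy uy ux
    by (intro triangle_in_object) (auto simp: B_eq_0_commute insert_commute)
  have 3: "edge y u @ edge u c \<approx> edge y c"
    using span_triple_radical_witness[OF uc w'] uc uy yc
    by (intro triangle_in_object) (auto simp: B_eq_0_commute insert_commute)
  have "edge a u @ edge u c \<approx> (edge a x @ edge x u) @ edge u c"
    by (intro equiv_words_append equiv_words_refl equiv_words_sym[OF 1])
  also have "\<dots> \<approx> (edge a x @ (edge x y @ edge y u)) @ edge u c"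
    by (intro equiv_words_append equiv_words_refl equiv_words_sym[OF 2])
  also have "\<dots> = edge a x @ edge x y @ (edge y u @ edge u c)" by simp
  also have "\<dots> \<approx> edge a x @ edge x y @ edge y c"
    by (intro equiv_words_append equiv_words_refl 3)
  finally show ?thesis .
qed

text \<open>If the span of the triangle contains the nonzero radical \<open>R = span {r}\<close>, it
  is \<open>span {a, b}\<close> plus \<open>R\<close> and is no object. In dimension 5 the three
  vertices have a common non-orthogonal point as soon as the field has a scalar other than 0 and
  1. In higher dimension, over any field, the point \<open>b'\<close> where the hyperbolic line
  through \<open>a\<close> and \<open>c\<close> meets \<open>span {b}\<close> plus
  \<open>R\<close> gives the same functional as \<open>b\<close> up to a factor; hence \<open>a,
  b, c\<close> and \<open>a, b', c\<close> are homotopic to one and the same path, and the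
  second of them stays on a line. Over the field with two elements \<open>a + b + c\<close>
  spans \<open>R\<close>, so that no point is non-orthogonal to all three vertices and the
  second argument is unavoidable; it needs a vector \<open>n\<close> orthogonal to two
  hyperbolic planes and outside \<open>R\<close>, for which dimension 5 leaves no room.\<close>
lemma collinearity_triangle:
  assumes ab: "B a b \<noteq> 0" and bc: "B b c \<noteq> 0" and ac: "B a c \<noteq> 0"
  shows "edge a b @ edge b c \<approx> edge a c"
proof (cases "span {a, b, c} \<inter> R = {0}")
  case True
  then show ?thesis using triangle_in_object assms by blast
next
  case False
  moreover have "0 \<in> span {a, b, c} \<inter> R" by (simp add: span_zero mem_radical_iff)
  ultimately obtain r where r: "r \<in> span {a, b, c}" "r \<in> R" "r \<noteq> 0" by blast
  then obtain i j k where eq: "r = i *s a + j *s b + k *s c"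
    unfolding mem_span_triple_iff by blast
  have r0: "B z r = 0" "B r z = 0" for z
    using r(2) by (auto simp: mem_radical_iff B_eq_0_commute)
  have k: "k \<noteq> 0" using r0 r(3) eq hyperbolic_pair_independent_mod_radical[OF ab, of i j] by auto
  have j: "j \<noteq> 0" using r0(1)[of a] k ac eq by (auto simp: B_bilinear)
  have R: "R = span {r}" using radical_eq_span r by blast
  have c_perp: "B c w = 0" if "B a w = 0" "B b w = 0" for w
    using r0(2)[of w] that k eq by (simp add: B_bilinear)
  have odd: "odd (dim UNIV)" using odd_dim_if_radical r by blast
  have "\<exists>v. v \<notin> span {a, b, r}"
    by (rule exists_not_in_span) (use dim_ge_4 in \<open>auto simp: card_insert_if\<close>)
  then obtain v where v: "v \<notin> span {a, b, r}" ..
  define m where "m = proj a b v"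
  have m: "B a m = 0" "B b m = 0" using proj_perp[OF ab] by (simp_all add: m_def)
  have mR: "m \<notin> R"
  proof
    assume "m \<in> R"
    then obtain l where "m = l *s r" unfolding R by (auto simp: span_singleton)
    with proj_decomp[of v b a] have "v \<in> span {a, b, r}"
      unfolding mem_span_triple_iff m_def by metis
    with v show False ..
  qed
  obtain w where w: "B a w = 0" "B b w = 0" "B m w \<noteq> 0"
    using nonperp_in_hyperbolic_perp[OF ab m mR] .
  show ?thesis
  proof (cases "dim UNIV = 5")
    case True
    then have "card (UNIV :: 'f set) \<noteq> 2" using not_exceptional by simp
    then have "UNIV \<noteq> {0, 1 ::'f}" by (metis card_2_iff zero_neq_one)
    then obtain t ::'f where t: "t \<noteq> 0" "t \<noteq> 1" by auto
    \<comment> \<open>The factor makes \<open>B s c\<close> equal to \<open>(1 - t) * B a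
      c\<close>.\<close>
    define l where "l = - (t * B a c / B b c)"
    have l: "l \<noteq> 0" using t ac bc by (simp add: l_def)
    define s where "s = a + l *s b + m"
    have cm: "B c m = 0" using c_perp m by simp
    have "B s c = (1 - t) * B a c"
      using bc cm B_eq_0_commute[of c m] by (simp add: s_def B_bilinear l_def field_simps)
    then have "B c s \<noteq> 0" using t ac B_eq_0_commute[of c s] by simp
    moreover have "B a s \<noteq> 0" "B b s \<noteq> 0"
      using ab l m B_eq_0_commute[of b a] by (simp_all add: s_def B_bilinear)
    moreover have "B s w \<noteq> 0" using w by (simp add: s_def B_bilinear)
    ultimately show ?thesis
      using triangle_via_common_neighbour[OF ab bc ac] w c_perp by blast
  next
    case False
    moreover have "dim UNIV \<noteq> 4" using odd by (metis even_numeral)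
    ultimately have large: "6 \<le> dim UNIV" using dim_ge_4 by linarith
    have "\<exists>v. v \<notin> span {a, b, m, w, r}"
      by (rule exists_not_in_span) (use large in \<open>auto simp: card_insert_if\<close>)
    then obtain v' where v': "v' \<notin> span {a, b, m, w, r}" ..
    define n where "n = proj m w (proj a b v')"
    have nm: "B m n = 0" "B w n = 0" using proj_perp[OF w(3)] by (simp_all add: n_def)
    have n: "B a n = 0" "B b n = 0"
      using proj_perp[OF ab] m w by (simp_all add: n_def B_proj)
    have "n \<notin> R"
    proof
      assume "n \<in> R"
      then obtain l where l: "n = l *s r" unfolding R by (auto simp: span_singleton)
      have "v' \<in> span {a, b, m, w, r}"
        by (subst proj_decomp[of v' b a], subst proj_decomp[of "proj a b v'" w m])
           (simp add: n_def[symmetric] l span_add span_scale span_base)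
      with v' show False ..
    qed
    from nonperp_in_hyperbolic_perp[OF ab n this]
    obtain w' where w': "B a w' = 0" "B b w' = 0" "B n w' \<noteq> 0" .
    \<comment> \<open>The summands \<open>m\<close> and \<open>n\<close> move \<open>x\<close>
      and \<open>y\<close> out of the plane containing \<open>R\<close>; since
      \<open>n\<close> is orthogonal to \<open>w\<close>, the functional of \<open>w\<close>
      sees \<open>x\<close> but not \<open>y\<close>.\<close>
    define x where "x = a + b + m"
    define y where "y = a + n"
    define b' where "b' = i *s a + k *s c"
    have b': "b' = r - j *s b" by (simp add: b'_def eq)
    have Bb': "B b' z = - j * B b z" for z by (simp add: b' B_bilinear r0)
    have via: "edge a u @ edge u c \<approx> edge a x @ edge x y @ edge y c"
      if u: "\<And>z. B u z = e * B b z" and e: "e \<noteq> 0" for u e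
    proof (rule triangle_meeting_radical_via_path[where w = w and w' = w'])
      have sym: "B a b \<noteq> 0" "B b a \<noteq> 0" "B m a = 0" "B m b = 0" "B n a = 0" "B n b = 0"
        using ab m n by (auto simp: B_eq_0_commute)
      show "B a u \<noteq> 0" using u[of a] e sym(2) B_eq_0_commute[of u a] by simp
      show "B u c \<noteq> 0" using u e bc by simp
      show "B a x \<noteq> 0" using sym m by (simp add: x_def B_bilinear)
      show "B x y \<noteq> 0" using sym n nm by (simp add: x_def y_def B_bilinear)
      have "B y r = j * B a b + k * B y c" using sym by (simp add: eq y_def B_bilinear)
      then show "B y c \<noteq> 0" using r0 j ab by auto
      show "B u x \<noteq> 0" using u e sym m by (simp add: x_def B_bilinear)
      show "B u y \<noteq> 0" using u e sym n by (simp add: y_def B_bilinear)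
      show "B a w = 0" "B u w = 0" using w u by auto
      show "B y w = 0" using w nm B_eq_0_commute[of n w] by (simp add: y_def B_bilinear)
      show "B x w \<noteq> 0" using w by (simp add: x_def B_bilinear)
      show "B u w' = 0" "B c w' = 0" using w' u c_perp by auto
      show "B y w' \<noteq> 0" using w' by (simp add: y_def B_bilinear)
    qed
    have "edge a b @ edge b c \<approx> edge a x @ edge x y @ edge y c"
      by (rule via[of b 1]) auto
    also have "\<dots> \<approx> edge a b' @ edge b' c"
      by (rule equiv_words_sym, rule via[OF Bb']) (use j in simp)
    also have "\<dots> \<approx> edge a c"
    proof (rule triangle_in_object)
      show "B a b' \<noteq> 0" using k ac by (simp add: b'_def B_bilinear)
      show "B b' c \<noteq> 0" using Bb' j bc by simp
      have "b' \<in> span {a, c}" unfolding mem_span_pair_iff b'_def by blast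
      then have "span {a, b', c} = span {a, c}"
        by (metis insert_commute span_redundant)
      then show "span {a, b', c} \<inter> R = {0}"
        using line_meets_radical_trivially[OF ac] by simp
    qed (fact ac)
    finally show ?thesis .
  qed
qed

section \<open>Contracting long point paths\<close>

text \<open>When both diagonals \<open>a, c\<close> and \<open>b, d\<close> of the quadrangle are
  orthogonal pairs, \<open>a + b\<close> is non-orthogonal to all four vertices.\<close>
lemma two_paths_equiv:
  assumes ab: "B a b \<noteq> 0" and bc: "B b c \<noteq> 0" and ad: "B a d \<noteq> 0" and dc: "B d c \<noteq> 0"
  shows "edge a b @ edge b c \<approx> edge a d @ edge d c"
proof -
  have via: "edge a x @ edge x c \<approx> edge a t @ edge t c"
    if "B a x \<noteq> 0" "B x c \<noteq> 0" "B a t \<noteq> 0" "B t c \<noteq> 0" "B x t \<noteq> 0" for x t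
  proof -
    have "edge a x @ edge x c \<approx> edge a t @ (edge t x @ edge x c)"
      using equiv_words_append[OF equiv_words_sym[OF collinearity_triangle[of a t x]] equiv_words_refl] that
      by (auto simp: B_eq_0_commute)
    also have "\<dots> \<approx> edge a t @ edge t c"
      using that by (intro equiv_words_append equiv_words_refl collinearity_triangle) (auto simp: B_eq_0_commute)
    finally show ?thesis .
  qed
  consider "B a c \<noteq> 0" | "B b d \<noteq> 0" | "B a c = 0" "B b d = 0" by blast
  then show ?thesis
  proof cases
    case 1
    then show ?thesis
      using collinearity_triangle[OF ab bc] collinearity_triangle[OF ad dc] equiv_words_sym equiv_words_trans by blast
  next
    case 2
    then show ?thesis using via assms by blast
  next
    case 3
    define t where "t = a + b"
    have t: "B a t \<noteq> 0" "B t c \<noteq> 0" "B b t \<noteq> 0" "B d t \<noteq> 0"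
      using assms 3 B_eq_0_commute[of b d] B_eq_0_commute[of b a] B_eq_0_commute[of d a]
      by (auto simp: t_def B_bilinear)
    have "edge a b @ edge b c \<approx> edge a t @ edge t c" using via t ab bc by blast
    also have "\<dots> \<approx> edge a d @ edge d c" using via t ad dc equiv_words_sym by blast
    finally show ?thesis .
  qed
qed

text \<open>If neither \<open>a, c\<close> nor \<open>b, d\<close> can be joined directly, \<open>b +
  c\<close> is a common neighbour of \<open>a\<close>, \<open>c\<close> and \<open>d\<close>.
  The end points \<open>a\<close> and \<open>d\<close> are arbitrary, so this also handles
  closed paths.\<close>
lemma three_path_shortens:
  assumes ab: "B a b \<noteq> 0" and bc: "B b c \<noteq> 0" and cd: "B c d \<noteq> 0"
  shows "\<exists>t. B a t \<noteq> 0 \<and> B t d \<noteq> 0 \<and> edge a b @ edge b c @ edge c d \<approx> edge a t @ edge t d"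
proof -
  consider "B a c \<noteq> 0" | "B b d \<noteq> 0" | "B a c = 0" "B b d = 0" by blast
  then show ?thesis
  proof cases
    case 1
    then have "(edge a b @ edge b c) @ edge c d \<approx> edge a c @ edge c d"
      by (intro equiv_words_append equiv_words_refl collinearity_triangle ab bc)
    then show ?thesis using 1 cd by auto
  next
    case 2
    then have "edge a b @ edge b c @ edge c d \<approx> edge a b @ edge b d"
      by (intro equiv_words_append equiv_words_refl collinearity_triangle bc cd)
    then show ?thesis using 2 ab by auto
  next
    case 3
    define t where "t = b + c"
    have t: "B a t \<noteq> 0" "B t c \<noteq> 0" "B t d \<noteq> 0"
      using assms 3 by (simp_all add: t_def B_bilinear)
    have "(edge a b @ edge b c) @ edge c d \<approx> (edge a t @ edge t c) @ edge c d"
      by (intro equiv_words_append equiv_words_refl two_paths_equiv ab bc t)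
    also have "\<dots> = edge a t @ (edge t c @ edge c d)" by simp
    also have "\<dots> \<approx> edge a t @ edge t d"
      by (intro equiv_words_append equiv_words_refl collinearity_triangle cd t)
    finally show ?thesis using t by auto
  qed
qed

lemma four_path_shortens:
  assumes "B a b \<noteq> 0" "B b c \<noteq> 0" "B c d \<noteq> 0" "B d e \<noteq> 0"
  shows "\<exists>t. B a t \<noteq> 0 \<and> B t e \<noteq> 0 \<and>
    edge a b @ edge b c @ edge c d @ edge d e \<approx> edge a t @ edge t e"
proof -
  obtain s where s: "B a s \<noteq> 0" "B s d \<noteq> 0" "edge a b @ edge b c @ edge c d \<approx> edge a s @ edge s d"
    using three_path_shortens assms by blast
  obtain t where t: "B a t \<noteq> 0" "B t e \<noteq> 0" "edge a s @ edge s d @ edge d e \<approx> edge a t @ edge t e"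
    using three_path_shortens s assms by blast
  have "edge a b @ edge b c @ edge c d @ edge d e \<approx> edge a s @ edge s d @ edge d e"
    using equiv_words_append[OF s(3) equiv_words_refl[of "edge d e"]] by simp
  then show ?thesis using t equiv_words_trans by blast
qed

section \<open>From objects to points\<close>

text \<open>A point of each object, chosen once and for all: in \<open>walk_normal_form\<close> the
  two ends of a closed walk then receive the same vector.\<close>
definition base :: "'v set \<Rightarrow> 'v" where
  "base X = (SOME a. a \<in> X \<and> a \<noteq> 0 \<and> incident \<Gamma> (span {a}) X)"

lemma base:
  assumes "X \<in> objects \<Gamma>"
  shows "base X \<in> X" "base X \<noteq> 0" "incident \<Gamma> (span {base X}) X"
proof -
  have X: "subspace X" "1 \<le> dim X" "dim (radical B X) \<le> 1" using assms by (auto simp: objects_iff)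
  have "\<exists>a. a \<in> X \<and> a \<noteq> 0 \<and> incident \<Gamma> (span {a}) X"
  \<comment> \<open>An object equal to its radical is a point; any other contains a vector off
    its radical.\<close>
  proof (cases "X = radical B X")
    case True
    then have "dim X = 1" using X by simp
    then obtain a where a: "a \<in> X" "a \<noteq> 0" using X dim_eq_0[of X] by fastforce
    then have "span {a} = X"
      using X \<open>dim X = 1\<close> by (intro subspace_dim_equal) (auto simp: span_minimal)
    then show ?thesis using a by (auto simp: incident_iff)
  next
    case False
    then obtain a y where "a \<in> X" "y \<in> X" "B a y \<noteq> 0"
      unfolding set_eq_iff mem_radical_iff by blast
    then show ?thesis using incident_point[OF X(1)] by (intro exI[of _ a]) auto
  qed
  from someI_ex[OF this] show "base X \<in> X" "base X \<noteq> 0" "incident \<Gamma> (span {base X}) X"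
    unfolding base_def by auto
qed

lemma base_nonperp:
  assumes "X \<in> objects \<Gamma>"
  shows "\<exists>y. B (base X) y \<noteq> 0"
proof -
  have "X \<inter> R = {0}" using assms by (simp add: objects_iff)
  then have "base X \<notin> R" using base[OF assms] by blast
  then show ?thesis by (auto simp: mem_radical_iff)
qed

lemma base_point_object: "X \<in> objects \<Gamma> \<Longrightarrow> span {base X} \<in> objects \<Gamma>"
  using base_nonperp point_object by blast

text \<open>If \<open>X\<close> is smaller than \<open>Y\<close>, incidence keeps every nonzero
  vector of \<open>X\<close> off the radical of \<open>Y\<close>; if \<open>X = Y\<close>, the
  choice of the base point does, as \<open>Y\<close> is larger than a point.\<close>
lemma base_nonperp_in_larger:
  assumes X: "X \<in> objects \<Gamma>" and Y: "Y \<in> objects \<Gamma>"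
    and XY: "X = Y \<or> dim X < dim Y" "incident \<Gamma> X Y" and dimY: "dim Y \<noteq> 1"
  shows "base X \<in> Y" "\<exists>y\<in>Y. B (base X) y \<noteq> 0" "incident \<Gamma> (span {base X}) Y"
proof -
  show in_Y: "base X \<in> Y" using XY base(1)[OF X] by (auto simp: incident_iff)
  have "base X \<notin> radical B Y"
  proof (cases "X = Y")
    case True
    have "dim (span {base X}) = 1" using base[OF X] by simp
    moreover have "1 \<le> dim Y" using Y by (simp add: objects_iff)
    ultimately have "span {base X} \<noteq> Y" "\<not> dim Y < dim (span {base X})"
      using dimY by (metis, linarith)
    then have "span {base X} \<inter> radical B Y = {0}"
      using base(3)[OF X] True by (auto simp: incident_iff)
    then show ?thesis using base(2)[OF X] span_base[of "base X" "{base X}"] by blast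
  next
    case False
    then have "X \<inter> radical B Y = {0}" using XY by (auto simp: incident_iff)
    then show ?thesis using base[OF X] by blast
  qed
  then show "\<exists>y\<in>Y. B (base X) y \<noteq> 0" using in_Y by (auto simp: mem_radical_iff)
  then show "incident \<Gamma> (span {base X}) Y"
    using incident_point[OF _ in_Y] Y by (auto simp: objects_iff)
qed

text \<open>The larger of the two objects contains both base points off its radical, hence a common
  neighbour \<open>s\<close> of them, and serves as the apex of a cone.\<close>
lemma incidence_lifts_to_edges:
  assumes X: "X \<in> objects \<Gamma>" and Y: "Y \<in> objects \<Gamma>" and XY: "X \<noteq> Y" "incident \<Gamma> X Y"
  shows "\<exists>s. B (base X) s \<noteq> 0 \<and> B s (base Y) \<noteq> 0 \<and>
    [span {base X}, X, Y] \<approx> edge (base X) s @ edge s (base Y) @ [Y]"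
proof -
  define M where "M = (if dim X < dim Y then Y else X)"
  have "dim X < dim Y \<or> dim Y < dim X" using XY by (auto simp: incident_iff)
  moreover have "1 \<le> dim X" "1 \<le> dim Y" using X Y by (simp_all add: objects_iff)
  ultimately have M: "M \<in> objects \<Gamma>" "dim M \<noteq> 1"
    and MX: "X = M \<or> dim X < dim M" "incident \<Gamma> X M"
    and MY: "Y = M \<or> dim Y < dim M" "incident \<Gamma> Y M"
    using X Y XY(2) incident_sym[OF XY(2)] incident_refl[OF X] incident_refl[OF Y]
    by (auto simp: M_def)
  have M_sub: "subspace M" using M by (simp add: objects_iff)
  note bX = base_nonperp_in_larger[OF X M(1) MX M(2)]
  note bY = base_nonperp_in_larger[OF Y M(1) MY M(2)]
  obtain s where s: "s \<in> M" "B (base X) s \<noteq> 0" "B (base Y) s \<noteq> 0"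
    using exists_common_nonperp[OF M_sub bX(2) bY(2)] by blast
  then have s': "B s (base Y) \<noteq> 0" by (simp add: B_eq_0_commute)
  have "[span {base X}, X, Y] \<approx> (edge (base X) s @ edge s (base Y)) @ [Y]"
  proof (rule walks_in_cone_equiv[where Z = M])
    show "walk [span {base X}, X, Y]"
      using base[OF X] base_point_object[OF X] X Y XY by (simp add: walk_def)
    show "walk ((edge (base X) s @ edge s (base Y)) @ [Y])"
      using base[OF Y] Y s(2) s' by (intro walk_append walk_edges) (auto simp: walk_def)
    fix x assume "x \<in> set [span {base X}, X, Y] \<union> set ((edge (base X) s @ edge s (base Y)) @ [Y])"
    then consider "x = span {base X} \<or> x = X \<or> x = Y"
      | "x \<in> set (edge (base X) s)" | "x \<in> set (edge s (base Y))"
      by auto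
    then show "incident \<Gamma> x M"
    proof cases
      case 1
      then show ?thesis using bX(3) MX(2) MY(2) by blast
    next
      case 2
      then show ?thesis by (rule edge_incident[OF M_sub bX(1) s(1,2)])
    next
      case 3
      then show ?thesis by (rule edge_incident[OF M_sub s(1) bY(1) s'])
    qed
  qed (use M in auto)
  then show ?thesis using s s' by auto
qed

text \<open>Each step of the walk contributes two edges between base points, and a path of four edges
  shortens to two edges again.\<close>
lemma walk_normal_form:
  assumes "walk xs"
  shows "\<exists>t. B (base (hd xs)) t \<noteq> 0 \<and> B t (base (last xs)) \<noteq> 0 \<and>
    [span {base (hd xs)}] @ xs \<approx> edge (base (hd xs)) t @ edge t (base (last xs)) @ [last xs]"
  using assms
proof (induction xs)
  case Nil
  then show ?case by (simp add: walk_def)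
next
  case (Cons X xs)
  have X: "X \<in> objects \<Gamma>" using Cons.prems by (simp add: walk_def)
  show ?case
  proof (cases "xs = []")
    case True
    obtain t where t: "B (base X) t \<noteq> 0" using base_nonperp[OF X] by blast
    have "(edge (base X) t @ edge t (base X)) @ [X] \<approx> [span {base X}] @ [X]"
      by (intro equiv_words_append equiv_words_refl edge_reverse t)
    then show ?thesis
      using t True equiv_words_sym by (intro exI[of _ t]) (auto simp: B_eq_0_commute)
  next
    case False
    then obtain Y ys where xs: "xs = Y # ys" by (cases xs) auto
    have Y: "Y \<in> objects \<Gamma>" and XY: "incident \<Gamma> X Y" and w: "walk xs"
      using Cons.prems xs by (auto simp: walk_def)
    obtain t where t: "B (base Y) t \<noteq> 0" "B t (base (last xs)) \<noteq> 0"
      "[span {base Y}] @ xs \<approx> edge (base Y) t @ edge t (base (last xs)) @ [last xs]"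
      using Cons.IH[OF w] xs by auto
    show ?thesis
    proof (cases "X = Y")
      case True
      have "[span {base X}] @ X # xs = [span {base X}] @ [X, X] @ ys" using True xs by simp
      also have "\<dots> \<approx> [span {base X}] @ [X] @ ys"
        by (intro equiv_words_append equiv_words_refl equiv_stutter X)
      also have "\<dots> = [span {base Y}] @ xs" using True xs by simp
      also note t(3)
      finally have "[span {base X}] @ X # xs \<approx> edge (base Y) t @ edge t (base (last xs)) @ [last xs]" .
      then show ?thesis using t True xs by auto
    next
      case False
      obtain s where s: "B (base X) s \<noteq> 0" "B s (base Y) \<noteq> 0"
        "[span {base X}, X, Y] \<approx> edge (base X) s @ edge s (base Y) @ [Y]"
        using incidence_lifts_to_edges[OF X Y False XY] by blast
      obtain t' where t': "B (base X) t' \<noteq> 0" "B t' (base (last xs)) \<noteq> 0"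
        "edge (base X) s @ edge s (base Y) @ edge (base Y) t @ edge t (base (last xs))
          \<approx> edge (base X) t' @ edge t' (base (last xs))"
        using four_path_shortens[OF s(1,2) t(1,2)] by blast
      have "[span {base X}] @ X # xs \<approx> (edge (base X) s @ edge s (base Y) @ [Y]) @ ys"
        using equiv_words_append[OF s(3) equiv_words_refl[of ys]] xs by simp
      also have "\<dots> = edge (base X) s @ edge s (base Y) @ xs" using xs by simp
      also have "\<dots> \<approx> edge (base X) s @ (edge s (base Y) @ [span {base Y}]) @ xs"
        by (intro equiv_words_append equiv_words_refl equiv_words_sym[OF edge_end] s)
      also have "\<dots> = (edge (base X) s @ edge s (base Y)) @ [span {base Y}] @ xs" by simp
      also have "\<dots> \<approx> (edge (base X) s @ edge s (base Y)) @
          edge (base Y) t @ edge t (base (last xs)) @ [last xs]"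
        by (intro equiv_words_append equiv_words_refl t)
      also have "\<dots> = (edge (base X) s @ edge s (base Y) @ edge (base Y) t @ edge t (base (last xs))) @ [last xs]"
        by simp
      also have "\<dots> \<approx> (edge (base X) t' @ edge t' (base (last xs))) @ [last xs]"
        by (intro equiv_words_append equiv_words_refl t')
      finally show ?thesis using t' xs by auto
    qed
  qed
qed

text \<open>In the normal form of a closed walk the two edges are a backtrack.\<close>
lemma closed_walk_null:
  assumes w: "walk xs" and closed: "hd xs = last xs"
  shows "xs \<approx> [hd xs]"
proof -
  obtain X ys where xs: "xs = X # ys" using w by (cases xs) (auto simp: walk_def)
  have X: "X \<in> objects \<Gamma>" using w xs by (simp add: walk_def)
  let ?a = "base X"
  note a = base_point_object[OF X] base(3)[OF X] base(3)[OF X, THEN incident_sym]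
  obtain t where t: "B ?a t \<noteq> 0" "[span {?a}] @ xs \<approx> edge ?a t @ edge t ?a @ [X]"
    using walk_normal_form[OF w] closed xs by auto
  have detour: "[X, span {?a}, X] \<approx> [X]" using equiv_backtrack X a by blast
  have "xs \<approx> [X, span {?a}, X] @ ys"
    using equiv_words_append[OF equiv_words_sym[OF detour] equiv_words_refl[of ys]] xs by simp
  also have "\<dots> = [X] @ [span {?a}] @ xs" using xs by simp
  also have "\<dots> \<approx> [X] @ edge ?a t @ edge t ?a @ [X]"
    by (intro equiv_words_append equiv_words_refl t)
  also have "\<dots> = [X] @ (edge ?a t @ edge t ?a) @ [X]" by simp
  also have "\<dots> \<approx> [X] @ [span {?a}] @ [X]"
    by (intro equiv_words_append equiv_words_refl edge_reverse t)
  also have "\<dots> \<approx> [X]" using detour by simp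
  finally show ?thesis using xs by simp
qed

lemma objects_joined_by_walk:
  assumes X: "X \<in> objects \<Gamma>" and Y: "Y \<in> objects \<Gamma>"
  shows "\<exists>xs. walk xs \<and> hd xs = X \<and> last xs = Y"
proof -
  obtain t where t: "B (base X) t \<noteq> 0" "B (base Y) t \<noteq> 0"
    using exists_common_nonperp[of UNIV "base X" "base Y"] base_nonperp X Y by auto
  have "walk ([X] @ (edge (base X) t @ edge t (base Y)) @ [Y])"
    using base(3)[OF X, THEN incident_sym] base(3)[OF Y] X Y t
    by (intro walk_append walk_edges) (auto simp: walk_def B_eq_0_commute)
  then show ?thesis by (intro exI conjI) auto
qed

theorem geometry_simply_connected: "simply_connected_geometry \<Gamma>"
  using simply_connected_if_walks objects_joined_by_walk closed_walk_null by blast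

end

theorem proposition4p2:
  fixes scale :: "'f::field \<Rightarrow> 'v::ab_group_add \<Rightarrow> 'v"
    and Basis :: "'v set"
    and B :: "'v \<Rightarrow> 'v \<Rightarrow> 'f"
    and n :: nat
  assumes "finite_dimensional_vector_space scale Basis"
    and "n = vector_space.dim scale (UNIV :: 'v set)"
    and "vector_space.symplectic_form scale B"
    and "vector_space.maximal_rank scale B"
    and "n \<noteq> 2" and "n \<noteq> 3"
    and "\<not> (n = 5 \<and> card (UNIV :: 'f set) = 2)"
  shows "simply_connected_geometry (vector_space.symplectic_geometry scale B)"
proof -
  interpret finite_dimensional_vector_space scale Basis by fact
  show ?thesis
  proof (cases "n < 2")
    case True
    then have "objects (symplectic_geometry B) = {}"
      using assms(2) by (auto simp: symplectic_geometry_def)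
    then show ?thesis
      by (auto simp: simply_connected_geometry_def connected_geometry_def is_cycle_def is_path_def)
  next
    case False
    then have "4 \<le> n" using assms(5,6) by linarith
    then interpret large_symplectic_space scale Basis B
      using assms by unfold_locales simp_all
    show ?thesis by (rule geometry_simply_connected)
  qed
qed

end
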